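(* Let $c(x,y)=h(y-x)$ on $\mathbb{R}\times\mathbb{R}$ with $h:\mathbb{R}\to[0,\infty)$ strictly convex, and suppose $c(x,y)\le c_X(x)+c_Y(y)$ for all $x,y$, for fixed measurable $c_X,c_Y:\mathbb{R}\to\mathbb{R}$. Let $a$ and $b$ be finite signed Borel measures on $\mathbb{R}$ with the same finite-length signature $(z_1,\dots,z_n)$, and let $\alpha:=|a|$ and $\beta:=|b|$ be their absolute value (total variation) measures, with finite moments $c_X\in L^1(\alpha)$ and $c_Y\in L^1(\beta)$. Let $\gamma$ be the optimal coupling between $\alpha$ and $\beta$, and $K^\gamma$ the kernel associated to $\gamma$. Then $K^\gamma$ sends $a$ to $b$, i.e. $aK^\gamma=b$.
   Context: For finite non-negative measures $\alpha,\beta$ of equal mass, a coupling is a non-negative measure on $\mathbb{R}\times\mathbb{R}$ with marginals $\alpha$ and $\beta$; it is optimal if it minimizes $\int c\,d\gamma$ among all couplings. For strictly convex $h$ and finite optimal cost, the optimal coupling is unique and equals the monotone coupling $(G_\alpha,G_\beta)_\#(\mathscr{L}\restriction[0,m])$, where $m$ is the common mass, $\mathscr{L}$ is Lebesgue measure and $G_\alpha,G_\beta$ are the pseudo-inverses of the distribution functions of $\alpha,\beta$. A signed measure $a$ with Jordan decomposition $a=a^+-a^-$ has finite-length signature if it has finite mass and there are $n\ge1$ and points $-\infty=p_0<p_1<\dots<p_n=\infty$ (with $(p_{n-1},p_n]$ read as $(p_{n-1},\infty)$) such that $a=\sum_{i=1}^n a^i$, where the $a^i$ are mutually singular, each $a^i$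 is carried by $(p_{i-1},p_i]$ and equals either $a^+\restriction_{(p_{i-1},p_i]}$ or $-a^-\restriction_{(p_{i-1},p_i]}$, and $a^i$ has opposite sign to $a^{i-1}$ and $a^{i+1}$ when they exist. The signature of $a$ is $(z_1,\dots,z_n)$ with $z_i:=a((p_{i-1},p_i])$; the intervals $(p_{i-1},p_i]$ are the signature intervals. The kernel $K^\gamma$ associated to a coupling $\gamma$ of $\alpha$ and $\beta$ acts on finite signed measures $\eta\ll\alpha$ with bounded density and $c_X\in L^1(|\eta|)$ by $\eta K^\gamma:=(\operatorname{proj}_Y)_\#\big(\tfrac{d\eta}{d\alpha}(x)\,\gamma\big)$, where $\operatorname{proj}_Y(x,y)=y$. *)

theory Defs
  imports "HOL-Analysis.Analysis"
begin

definition strictly_convex :: "(real \<Rightarrow> real) \<Rightarrow> bool" where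
  "strictly_convex h \<longleftrightarrow>
     (\<forall>x y t. x \<noteq> y \<longrightarrow> 0 < t \<longrightarrow> t < 1 \<longrightarrow>
        h ((1 - t) * x + t * y) < (1 - t) * h x + t * h y)"

section \<open>Finite signed Borel measures\<close>

text \<open>
  Signed measures are real-valued set functions, and only their values on Borel sets carry meaning.
  Being real-valued and countably additive, they have finite total variation.
\<close>

definition finite_signed_measure :: "('a::topological_space set \<Rightarrow> real) \<Rightarrow> bool" where
  "finite_signed_measure \<mu> \<longleftrightarrow>
     \<mu> {} = 0 \<and>
     (\<forall>A :: nat \<Rightarrow> 'a set. range A \<subseteq> sets borel \<longrightarrow> disjoint_family A \<longrightarrow>
        (\<lambda>i. \<mu> (A i)) sums \<mu> (\<Union>i. A i))"

definition carried_by :: "('a::topological_space set \<Rightarrow> real) \<Rightarrow> 'a set \<Rightarrow> bool" where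
  "carried_by \<mu> S \<longleftrightarrow> (\<forall>A\<in>sets borel. A \<inter> S = {} \<longrightarrow> \<mu> A = 0)"

definition mutually_singular ::
    "('a::topological_space set \<Rightarrow> real) \<Rightarrow> ('a set \<Rightarrow> real) \<Rightarrow> bool" where
  "mutually_singular \<mu> \<nu> \<longleftrightarrow> (\<exists>S\<in>sets borel. carried_by \<mu> S \<and> carried_by \<nu> (- S))"

definition jordan_decomposition ::
    "('a::topological_space set \<Rightarrow> real) \<Rightarrow> 'a measure \<Rightarrow> 'a measure \<Rightarrow> bool" where
  "jordan_decomposition \<mu> P N \<longleftrightarrow>
     finite_measure P \<and> sets P = sets borel \<and>
     finite_measure N \<and> sets N = sets borel \<and>
     mutually_singular (measure P) (measure N) \<and>
     (\<forall>A\<in>sets borel. \<mu> A = measure P A - measure N A)"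

text \<open>
  For a finite signed measure the pair in \<open>jordan_decomposition\<close> exists and is unique
  (Hahn--Jordan), so the following descriptions are proper.
\<close>

definition pos_part :: "('a::topological_space set \<Rightarrow> real) \<Rightarrow> 'a measure" where
  "pos_part \<mu> = (THE P. \<exists>N. jordan_decomposition \<mu> P N)"

definition neg_part :: "('a::topological_space set \<Rightarrow> real) \<Rightarrow> 'a measure" where
  "neg_part \<mu> = (THE N. \<exists>P. jordan_decomposition \<mu> P N)"

definition total_variation :: "('a::topological_space set \<Rightarrow> real) \<Rightarrow> 'a measure" where
  "total_variation \<mu> =
     measure_of UNIV (sets borel) (\<lambda>A. emeasure (pos_part \<mu>) A + emeasure (neg_part \<mu>) A)"

section \<open>Signatures\<close>

text \<open>
  Indices are shifted by one: the \<open>i\<close>-th signature interval, \<open>i < n\<close>, is \<open>(p i, p (Suc i)]\<close>.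
  If \<open>p (Suc i) = \<infinity>\<close>, this is the open half-line above \<open>p i\<close>.
\<close>

definition signature_interval :: "(nat \<Rightarrow> ereal) \<Rightarrow> nat \<Rightarrow> real set" where
  "signature_interval p i = {x. p i < ereal x \<and> ereal x \<le> p (Suc i)}"

text \<open>
  The piece \<open>ai i\<close> is the restriction of the positive part where \<open>\<sigma> i\<close> holds, and minus the
  restriction of the negative part otherwise; consecutive pieces have opposite sign \<open>\<sigma>\<close>.
  A piece may be the zero measure, so zero entries are permitted in a signature.  Requiring
  nonzero pieces would only make the predicate more restrictive.
\<close>

definition has_signature :: "(real set \<Rightarrow> real) \<Rightarrow> real list \<Rightarrow> bool" where
  "has_signature a z \<longleftrightarrow>
     finite_signed_measure a \<and> length z \<ge> 1 \<and>
     (\<exists>(p :: nat \<Rightarrow> ereal) (ai :: nat \<Rightarrow> real set \<Rightarrow> real) (\<sigma> :: nat \<Rightarrow> bool).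
        p 0 = -\<infinity> \<and> p (length z) = \<infinity> \<and> (\<forall>i<length z. p i < p (Suc i)) \<and>
        (\<forall>A\<in>sets borel. a A = (\<Sum>i<length z. ai i A)) \<and>
        (\<forall>i<length z. \<forall>j<length z. i \<noteq> j \<longrightarrow> mutually_singular (ai i) (ai j)) \<and>
        (\<forall>i<length z. carried_by (ai i) (signature_interval p i)) \<and>
        (\<forall>i<length z. \<forall>A\<in>sets borel.
           ai i A = (if \<sigma> i then measure (pos_part a) (A \<inter> signature_interval p i)
                     else - measure (neg_part a) (A \<inter> signature_interval p i))) \<and>
        (\<forall>i. Suc i < length z \<longrightarrow> \<sigma> (Suc i) \<noteq> \<sigma> i) \<and>
        (\<forall>i<length z. z ! i = a (signature_interval p i)))"

section \<open>Couplings\<close>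

definition coupling :: "real measure \<Rightarrow> real measure \<Rightarrow> (real \<times> real) measure \<Rightarrow> bool" where
  "coupling \<alpha> \<beta> \<gamma> \<longleftrightarrow>
     sets \<gamma> = sets borel \<and> distr \<gamma> borel fst = \<alpha> \<and> distr \<gamma> borel snd = \<beta>"

text \<open>
  The cost is integrated as a nonnegative function, so this is the intended notion only for
  \<open>c \<ge> 0\<close>.
\<close>

definition optimal_coupling ::
    "(real \<Rightarrow> real \<Rightarrow> real) \<Rightarrow> real measure \<Rightarrow> real measure \<Rightarrow> (real \<times> real) measure \<Rightarrow> bool" where
  "optimal_coupling c \<alpha> \<beta> \<gamma> \<longleftrightarrow>
     coupling \<alpha> \<beta> \<gamma> \<and>
     (\<forall>\<gamma>'. coupling \<alpha> \<beta> \<gamma>' \<longrightarrow>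
        (\<integral>\<^sup>+(x, y). ennreal (c x y) \<partial>\<gamma>) \<le> (\<integral>\<^sup>+(x, y). ennreal (c x y) \<partial>\<gamma>'))"

section \<open>The kernel of a coupling\<close>

text \<open>The Radon--Nikodym derivative of \<open>\<eta>\<close> with respect to \<open>\<alpha>\<close>, via the Jordan parts of \<open>\<eta>\<close>.\<close>

definition signed_RN_deriv :: "real measure \<Rightarrow> (real set \<Rightarrow> real) \<Rightarrow> real \<Rightarrow> real" where
  "signed_RN_deriv \<alpha> \<eta> x =
     enn2real (RN_deriv \<alpha> (pos_part \<eta>) x) - enn2real (RN_deriv \<alpha> (neg_part \<eta>) x)"

definition signed_density :: "'a measure \<Rightarrow> ('a \<Rightarrow> real) \<Rightarrow> 'a set \<Rightarrow> real" where
  "signed_density M f = (\<lambda>B. LINT z:B|M. f z)"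

definition signed_distr :: "('a set \<Rightarrow> real) \<Rightarrow> ('a \<Rightarrow> 'b) \<Rightarrow> 'b set \<Rightarrow> real" where
  "signed_distr \<mu> g = (\<lambda>A. \<mu> (g -` A))"

text \<open>
  In the next two definitions, \<open>\<alpha>\<close> is the first marginal of the coupling \<open>\<gamma>\<close>.
  The density is determined only up to an \<open>\<alpha>\<close>-null set, hence boundedness is meant
  almost everywhere.
\<close>

definition kernel_domain :: "(real \<Rightarrow> real) \<Rightarrow> real measure \<Rightarrow> (real set \<Rightarrow> real) set" where
  "kernel_domain cX \<alpha> =
     {\<eta>. finite_signed_measure \<eta> \<and>
         absolutely_continuous \<alpha> (total_variation \<eta>) \<and>
         (\<exists>C. AE x in \<alpha>. \<bar>signed_RN_deriv \<alpha> \<eta> x\<bar> \<le> C) \<and>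
         integrable (total_variation \<eta>) cX}"

definition kernel_apply ::
    "real measure \<Rightarrow> (real \<times> real) measure \<Rightarrow> (real set \<Rightarrow> real) \<Rightarrow> real set \<Rightarrow> real" where
  "kernel_apply \<alpha> \<gamma> \<eta> =
     signed_distr (signed_density \<gamma> (\<lambda>(x, y). signed_RN_deriv \<alpha> \<eta> x)) snd"

end

theory Submission
  imports Defs
begin

text \<open>
  If the half-lines below \<open>p\<close> and below \<open>q\<close> have equal \<open>\<alpha>\<close>- and \<open>\<beta>\<close>-mass, an optimal \<open>\<gamma>\<close> respects
  this cut: otherwise it moves equal amounts of mass across it in both directions, and by strict
  convexity exchanging the partners of these two parts strictly lowers the finite cost.  The
  \<open>i\<close>-th signature intervals of \<open>a\<close> and \<open>b\<close> carry \<open>\<alpha>\<close>- and \<open>\<beta>\<close>-mass \<open>\<bar>z ! i\<bar>\<close>, so every cut between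
  consecutive intervals is respected and \<open>\<gamma>\<close> matches them interval by interval.  On them the density
  of \<open>a\<close> with respect to \<open>\<alpha>\<close> is the sign of \<open>z ! i\<close>, as is that of \<open>b\<close> with respect to \<open>\<beta>\<close>.
\<close>

section \<open>Hahn and Jordan decompositions\<close>

lemma signed_union:
  assumes "finite_signed_measure \<mu>" "A \<in> sets borel" "B \<in> sets borel" "A \<inter> B = {}"
  shows "\<mu> (A \<union> B) = \<mu> A + \<mu> B"
proof -
  have "range (binaryset A B) \<subseteq> sets borel" "disjoint_family (binaryset A B)"
    using assms by (auto simp: range_binaryset_eq disjoint_family_on_def binaryset_def)
  then have "(\<lambda>i. \<mu> (binaryset A B i)) sums \<mu> (\<Union>i. binaryset A B i)"
    using assms(1) unfolding finite_signed_measure_def by blast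
  then have "(\<lambda>i. \<mu> (binaryset A B i)) sums \<mu> (A \<union> B)"
    by (simp add: UN_binaryset_eq)
  moreover have "(\<lambda>i. \<mu> (binaryset A B i)) sums (\<mu> A + \<mu> B)"
    using assms(1) by (intro binaryset_sums) (simp add: finite_signed_measure_def)
  ultimately show ?thesis by (rule sums_unique2)
qed

lemma signed_diff:
  assumes "finite_signed_measure \<mu>" "A \<in> sets borel" "B \<in> sets borel" "B \<subseteq> A"
  shows "\<mu> (A - B) = \<mu> A - \<mu> B"
  using signed_union[OF assms(1), of B "A - B"] assms by (simp add: Un_absorb1)

lemma finite_signed_measure_uminus:
  "finite_signed_measure \<mu> \<Longrightarrow> finite_signed_measure (\<lambda>A. - \<mu> A)"
  unfolding finite_signed_measure_def by (auto intro: sums_minus)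

text \<open>Disjoint sets are removed greedily, each nearly as large as possible; since their measures
  are summable, nothing of positive measure is left over.\<close>

lemma greedy_exhaustion:
  fixes \<mu> :: "'a::topological_space set \<Rightarrow> real"
  assumes \<mu>: "finite_signed_measure \<mu>" and X: "X \<in> sets borel" and C: "C {}"
  obtains B :: "nat \<Rightarrow> 'a set"
  where "\<And>n. B n \<in> sets borel" "\<And>n. B n \<subseteq> X" "\<And>n. C (B n)" "\<And>n. \<mu> (B n) \<ge> 0"
    "disjoint_family B"
    "\<And>E. E \<in> sets borel \<Longrightarrow> E \<subseteq> X - (\<Union>n. B n) \<Longrightarrow> C E \<Longrightarrow> \<mu> E \<le> 0"
proof -
  define ok where "ok Y E \<longleftrightarrow> E \<in> sets borel \<and> E \<subseteq> Y \<and> C E" for Y E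
  have \<mu>0: "\<mu> {} = 0" using \<mu> by (simp add: finite_signed_measure_def)
  have step: "\<exists>D. ok Y D \<and> 0 \<le> \<mu> D \<and> (\<forall>E. ok Y E \<longrightarrow> min 1 (\<mu> E) \<le> 2 * \<mu> D)" for Y
  proof -
    \<comment> \<open>No upper bound for the values of \<mu> is available at this stage. Truncation
      at 1 makes the supremum finite, and a set with more than half of it serves as
      \<open>D\<close>; if the supremum is not positive, the empty set does.\<close>
    define S where "S = (\<lambda>E. min 1 (\<mu> E)) ` {E. ok Y E}"
    have bdd: "bdd_above S" unfolding S_def by (rule bdd_aboveI2[of _ _ 1]) auto
    have emp: "ok Y {}" using C by (simp add: ok_def)
    have S_le: "min 1 (\<mu> E) \<le> Sup S" if "ok Y E" for E
      using that bdd by (auto simp: S_def intro!: cSup_upper)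
    show ?thesis
    proof (cases "Sup S \<le> 0")
      case True
      then show ?thesis using emp \<mu>0 S_le by (intro exI[of _ "{}"]) force
    next
      case False
      then have "Sup S / 2 < Sup S" by simp
      moreover have "S \<noteq> {}" using emp by (auto simp: S_def)
      ultimately obtain s where "s \<in> S" "Sup S / 2 < s" using less_cSupD by blast
      then obtain D where "ok Y D" "Sup S / 2 < min 1 (\<mu> D)" unfolding S_def by blast
      then show ?thesis using S_le False by (intro exI[of _ D]) force
    qed
  qed
  define pick where
    "pick Y = (SOME D. ok Y D \<and> 0 \<le> \<mu> D \<and> (\<forall>E. ok Y E \<longrightarrow> min 1 (\<mu> E) \<le> 2 * \<mu> D))" for Y
  have pick: "ok Y (pick Y)" "0 \<le> \<mu> (pick Y)" "\<And>E. ok Y E \<Longrightarrow> min 1 (\<mu> E) \<le> 2 * \<mu> (pick Y)"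
    for Y using someI_ex[OF step[of Y]] unfolding pick_def by blast+
  \<comment> \<open>\<open>R n\<close> is what remains of \<open>X\<close> before the
    \<open>n\<close>-th removal, and \<open>B n\<close> is the set removed from it.\<close>
  define R where "R = rec_nat X (\<lambda>_ Y. Y - pick Y)"
  define B where "B n = pick (R n)" for n
  have R0: "R 0 = X" and RS: "R (Suc n) = R n - B n" for n by (simp_all add: R_def B_def)
  have Rdec: "R n \<subseteq> R m" if "m \<le> n" for m n
    using that by (induction rule: dec_induct) (auto simp: RS)
  have BR: "B n \<subseteq> R n" for n using pick(1)[of "R n"] by (simp add: B_def ok_def)
  have Bborel: "B n \<in> sets borel" for n using pick(1)[of "R n"] by (simp add: B_def ok_def)
  have "B m \<inter> B n = {}" if "m < n" for m n
    using Rdec[of "Suc m" n] that BR[of n] by (auto simp: RS)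
  then have disj: "disjoint_family B"
    unfolding disjoint_family_on_def by (metis Int_commute linorder_neqE_nat)
  have "(\<lambda>n. \<mu> (B n)) sums \<mu> (\<Union>n. B n)"
    using \<mu> Bborel disj unfolding finite_signed_measure_def by blast
  then have lim: "(\<lambda>n. \<mu> (B n)) \<longlonglongrightarrow> 0" by (simp add: sums_iff summable_LIMSEQ_zero)
  have R_eq: "X - (\<Union>n. B n) \<subseteq> R n" for n
    by (induction n) (auto simp: R0 RS)
  \<comment> \<open>A leftover set \<open>E\<close> was a candidate at every stage, so its truncated
    measure stays below \<open>2 * \<mu> (B n)\<close>, which tends to 0.\<close>
  have left: "\<mu> E \<le> 0" if "E \<in> sets borel" "E \<subseteq> X - (\<Union>n. B n)" "C E" for E
  proof -
    have "ok (R n) E" for n using that R_eq[of n] by (auto simp: ok_def)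
    then have "min 1 (\<mu> E) \<le> 2 * \<mu> (B n)" for n using pick(3) by (simp add: B_def)
    moreover have "(\<lambda>n. 2 * \<mu> (B n)) \<longlonglongrightarrow> 0" using tendsto_mult_left[OF lim, of 2] by simp
    ultimately have "min 1 (\<mu> E) \<le> 0" using LIMSEQ_le_const by blast
    then show ?thesis by linarith
  qed
  show ?thesis
  proof
    show "B n \<subseteq> X" for n using BR[of n] Rdec[of 0 n] by (simp add: R0)
    show "C (B n)" for n using pick(1)[of "R n"] by (simp add: B_def ok_def)
    show "\<mu> (B n) \<ge> 0" for n using pick(2) by (simp add: B_def)
  qed (use Bborel disj left in auto)
qed

text \<open>Exhausting \<open>D\<close> without any constraint removes a set of nonnegative measure,
  so the remainder \<open>A\<close> has no larger measure than \<open>D\<close>, and no subset of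
  positive measure survives in it.\<close>

lemma exists_nonpositive_subset:
  assumes \<mu>: "finite_signed_measure \<mu>" and D: "D \<in> sets borel"
  obtains A where "A \<in> sets borel" "A \<subseteq> D" "\<mu> A \<le> \<mu> D"
    "\<And>E. E \<in> sets borel \<Longrightarrow> E \<subseteq> A \<Longrightarrow> \<mu> E \<le> 0"
proof -
  obtain B :: "nat \<Rightarrow> 'a set" where B: "\<And>n. B n \<in> sets borel" "\<And>n. B n \<subseteq> D" "\<And>n. \<mu> (B n) \<ge> 0"
    "disjoint_family B" "\<And>E. E \<in> sets borel \<Longrightarrow> E \<subseteq> D - (\<Union>n. B n) \<Longrightarrow> \<mu> E \<le> 0"
    using greedy_exhaustion[OF \<mu> D, of "\<lambda>_. True"] by metis
  have "(\<lambda>n. \<mu> (B n)) sums \<mu> (\<Union>n. B n)"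
    using \<mu> B unfolding finite_signed_measure_def by blast
  then have "\<mu> (\<Union>n. B n) \<ge> 0" using sums_le[OF _ sums_zero, of "\<lambda>n. \<mu> (B n)"] B(3) by metis
  moreover have "\<mu> (D - (\<Union>n. B n)) = \<mu> D - \<mu> (\<Union>n. B n)"
    using B(1,2) D by (intro signed_diff[OF \<mu>]) auto
  ultimately have "\<mu> (D - (\<Union>n. B n)) \<le> \<mu> D" by simp
  moreover have "D - (\<Union>n. B n) \<in> sets borel" using B(1) D by auto
  ultimately show ?thesis using B(5) by (intro that) auto
qed

text \<open>The negative side is exhausted greedily by sets all of whose Borel subsets have measure
  at most 0. A set of negative measure outside their union would contain another such set of
  negative measure, which the exhaustion excludes.\<close>

theorem hahn_decomposition:
  fixes \<mu> :: "'a::topological_space set \<Rightarrow> real"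
  assumes \<mu>: "finite_signed_measure \<mu>"
  obtains S where "S \<in> sets borel" "\<And>E. E \<in> sets borel \<Longrightarrow> E \<subseteq> S \<Longrightarrow> \<mu> E \<ge> 0"
    "\<And>E. E \<in> sets borel \<Longrightarrow> E \<subseteq> - S \<Longrightarrow> \<mu> E \<le> 0"
proof -
  define C where "C A \<longleftrightarrow> (\<forall>E\<in>sets borel. E \<subseteq> A \<longrightarrow> \<mu> E \<le> 0)" for A
  have \<mu>0: "\<mu> {} = 0" using \<mu> by (simp add: finite_signed_measure_def)
  then have C0: "C {}" by (auto simp: C_def)
  obtain B :: "nat \<Rightarrow> 'a set" where B: "\<And>n. B n \<in> sets borel" "\<And>n. C (B n)" "disjoint_family B"
    "\<And>E. E \<in> sets borel \<Longrightarrow> E \<subseteq> UNIV - (\<Union>n. B n) \<Longrightarrow> C E \<Longrightarrow> - \<mu> E \<le> 0"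
    using greedy_exhaustion[OF finite_signed_measure_uminus[OF \<mu>], where X = UNIV and C = C]
      C0 sets.top[of borel, unfolded space_borel] by metis
  let ?N = "\<Union>n. B n"
  show ?thesis
  proof
    show "- ?N \<in> sets borel" using B(1) by auto
  next
    fix E assume E: "E \<in> sets borel" "E \<subseteq> - ?N"
    \<comment> \<open>\<open>A\<close> is itself a candidate of the exhaustion and lies outside the
      removed sets, hence its measure is at least 0; it is also at most that of
      \<open>E\<close>.\<close>
    obtain A where A: "A \<in> sets borel" "A \<subseteq> E" "\<mu> A \<le> \<mu> E" "C A"
      using exists_nonpositive_subset[OF \<mu> E(1)] unfolding C_def by metis
    have "\<mu> A \<ge> 0" using B(4)[of A] A E by auto
    then show "\<mu> E \<ge> 0" using A by simp
  next
    fix E assume E: "E \<in> sets borel" "E \<subseteq> - (- ?N)"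
    \<comment> \<open>A subset of the union is cut along the disjoint \<open>B n\<close>; each piece
      has measure at most 0, and so has their sum.\<close>
    have "range (\<lambda>n. E \<inter> B n) \<subseteq> sets borel" "disjoint_family (\<lambda>n. E \<inter> B n)"
      using E(1) B(1) by (auto intro: disjoint_family_on_bisimulation[OF B(3)])
    then have "(\<lambda>n. \<mu> (E \<inter> B n)) sums \<mu> (\<Union>n. E \<inter> B n)"
      using \<mu> unfolding finite_signed_measure_def by blast
    moreover have "(\<Union>n. E \<inter> B n) = E" using E by auto
    moreover have "\<mu> (E \<inter> B n) \<le> 0" for n using B(1,2)[of n] E(1) by (auto simp: C_def)
    ultimately show "\<mu> E \<le> 0" using sums_le[OF _ _ sums_zero, of "\<lambda>n. \<mu> (E \<inter> B n)"] by metis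
  qed
qed

text \<open>Nonnegativity inside \<open>S\<close> means that the coercion to \<open>ennreal\<close>
  loses nothing, so countable additivity carries over. This turns each side of a Hahn decomposition
  into a Jordan part.\<close>

lemma signed_measure_restrict:
  assumes \<mu>: "finite_signed_measure \<mu>" and S: "S \<in> sets borel"
    and nonneg: "\<And>E. E \<in> sets borel \<Longrightarrow> E \<subseteq> S \<Longrightarrow> \<mu> E \<ge> 0"
  obtains P where "finite_measure P" "sets P = sets borel"
    "\<And>A. A \<in> sets borel \<Longrightarrow> measure P A = \<mu> (A \<inter> S)"
proof -
  define P where "P = measure_of UNIV (sets borel) (\<lambda>A. ennreal (\<mu> (A \<inter> S)))"
  have sets_P: "sets P = sets borel"
    using sets.sigma_sets_eq[of borel] by (simp add: P_def)
  have "emeasure P A = ennreal (\<mu> (A \<inter> S))" if "A \<in> sets borel" for A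
    unfolding P_def
  proof (rule emeasure_measure_of_sigma)
    show "sigma_algebra UNIV (sets borel)" using sets.sigma_algebra_axioms[of borel] by simp
    show "positive (sets borel) (\<lambda>A. ennreal (\<mu> (A \<inter> S)))"
      using \<mu> by (simp add: positive_def finite_signed_measure_def)
    show "countably_additive (sets borel) (\<lambda>A. ennreal (\<mu> (A \<inter> S)))"
      unfolding countably_additive_def
    proof (intro allI impI)
      fix A :: "nat \<Rightarrow> 'a set" assume A: "range A \<subseteq> sets borel" "disjoint_family A"
      have "range (\<lambda>n. A n \<inter> S) \<subseteq> sets borel" "disjoint_family (\<lambda>n. A n \<inter> S)"
        using A S by (auto simp: disjoint_family_on_def)
      then have "(\<lambda>n. \<mu> (A n \<inter> S)) sums \<mu> (\<Union>n. A n \<inter> S)"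
        using \<mu> unfolding finite_signed_measure_def by blast
      moreover have "\<mu> (A n \<inter> S) \<ge> 0" for n using A S by (intro nonneg) auto
      ultimately have "(\<Sum>n. ennreal (\<mu> (A n \<inter> S))) = ennreal (\<mu> (\<Union>n. A n \<inter> S))"
        by (intro suminf_ennreal_eq) auto
      then show "(\<Sum>n. ennreal (\<mu> (A n \<inter> S))) = ennreal (\<mu> (\<Union> (range A) \<inter> S))" by simp
    qed
  qed (use that in auto)
  note em = this
  show ?thesis
  proof
    have sp: "space P = UNIV" using sets_P by (metis sets_eq_imp_space_eq space_borel)
    show "finite_measure P" by standard (simp add: sp em)
    show "measure P A = \<mu> (A \<inter> S)" if "A \<in> sets borel" for A
      using that S nonneg by (simp add: measure_def em)
  qed (fact sets_P)
qed

text \<open>For a Hahn set \<open>S\<close> the two parts are \<mu> on \<open>S\<close> and minus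
  \<mu> on its complement; \<open>S\<close> also witnesses their singularity.\<close>

lemma jordan_decomposition_exists:
  assumes \<mu>: "finite_signed_measure \<mu>"
  obtains P N where "jordan_decomposition \<mu> P N"
proof -
  obtain S where S: "S \<in> sets borel" "\<And>E. E \<in> sets borel \<Longrightarrow> E \<subseteq> S \<Longrightarrow> \<mu> E \<ge> 0"
    "\<And>E. E \<in> sets borel \<Longrightarrow> E \<subseteq> - S \<Longrightarrow> \<mu> E \<le> 0" using hahn_decomposition[OF \<mu>] by metis
  obtain P where P: "finite_measure P" "sets P = sets borel"
    "\<And>A. A \<in> sets borel \<Longrightarrow> measure P A = \<mu> (A \<inter> S)"
    using signed_measure_restrict[OF \<mu> S(1,2)] by metis
  obtain N where N: "finite_measure N" "sets N = sets borel"
    "\<And>A. A \<in> sets borel \<Longrightarrow> measure N A = - \<mu> (A \<inter> - S)"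
    using signed_measure_restrict[OF finite_signed_measure_uminus[OF \<mu>], of "- S"] S(1,3)
    by (metis borel_comp neg_0_le_iff_le)
  have \<mu>0: "\<mu> {} = 0" using \<mu> by (simp add: finite_signed_measure_def)
  have "mutually_singular (measure P) (measure N)"
    unfolding mutually_singular_def carried_by_def
    using S(1) P(3) N(3) \<mu>0 by (intro bexI[of _ S]) auto
  moreover have "\<mu> A = measure P A - measure N A" if "A \<in> sets borel" for A
    using signed_union[OF \<mu>, of "A \<inter> S" "A \<inter> - S"] that S(1) P(3) N(3)
    by (simp add: Int_Un_distrib[symmetric] disjoint_iff)
  ultimately show ?thesis using P(1,2) N(1,2) by (intro that[of P N]) (simp add: jordan_decomposition_def)
qed

text \<open>A set witnessing singularity behaves like a Hahn set: \<open>N\<close> vanishes on it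
  and \<open>P\<close> off it. The positive part is thereby expressed through \<mu> and
  \<open>S\<close> alone, which is what uniqueness requires.\<close>

lemma jordan_decomposition_carrier:
  assumes J: "jordan_decomposition \<mu> P N"
  obtains S where "S \<in> sets borel" "\<And>A. A \<in> sets borel \<Longrightarrow> measure P A = \<mu> (A \<inter> S)"
    "\<And>A. A \<in> sets borel \<Longrightarrow> A \<subseteq> - S \<Longrightarrow> \<mu> A \<le> 0"
proof -
  interpret P: finite_measure P using J by (simp add: jordan_decomposition_def)
  have sets: "sets P = sets borel" and \<mu>: "\<And>A. A \<in> sets borel \<Longrightarrow> \<mu> A = measure P A - measure N A"
    using J by (simp_all add: jordan_decomposition_def)
  have "mutually_singular (measure P) (measure N)" using J by (simp add: jordan_decomposition_def)
  then obtain S where S: "S \<in> sets borel" "carried_by (measure P) S" "carried_by (measure N) (- S)"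
    unfolding mutually_singular_def by blast
  show ?thesis
  proof
    fix A :: "'a set" assume A: "A \<in> sets borel"
    have "measure P A = measure P (A \<inter> S) + measure P (A - S)"
      using A S(1) sets by (subst P.finite_measure_Union[symmetric]) (auto simp: Int_Diff_Un)
    moreover have "measure P (A - S) = 0" using A S(1) by (intro S(2)[unfolded carried_by_def, rule_format]) auto
    moreover have "measure N (A \<inter> S) = 0" using A S(1) by (intro S(3)[unfolded carried_by_def, rule_format]) auto
    ultimately show "measure P A = \<mu> (A \<inter> S)" using \<mu>[of "A \<inter> S"] A S(1) by simp
  next
    fix A :: "'a set" assume A: "A \<in> sets borel" "A \<subseteq> - S"
    then have "measure P A = 0" by (intro S(2)[unfolded carried_by_def, rule_format]) auto
    then show "\<mu> A \<le> 0" using \<mu>[OF A(1)] by simp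
  qed (fact S(1))
qed

text \<open>Two decompositions yield carriers \<open>S\<close> and \<open>S'\<close>, and both
  positive parts give \<open>A\<close> the value \<open>\<mu> (A \<inter> S \<inter> S')\<close>.
  The negative parts then agree by subtraction.\<close>

lemma jordan_decomposition_unique:
  assumes fin: "finite_signed_measure \<mu>"
    and J: "jordan_decomposition \<mu> P N" and J': "jordan_decomposition \<mu> P' N'"
  shows "P = P'" "N = N'"
proof -
  obtain S where S: "S \<in> sets borel" "\<And>A. A \<in> sets borel \<Longrightarrow> measure P A = \<mu> (A \<inter> S)"
    "\<And>A. A \<in> sets borel \<Longrightarrow> A \<subseteq> - S \<Longrightarrow> \<mu> A \<le> 0" using jordan_decomposition_carrier[OF J] by metis
  obtain S' where S': "S' \<in> sets borel" "\<And>A. A \<in> sets borel \<Longrightarrow> measure P' A = \<mu> (A \<inter> S')"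
    "\<And>A. A \<in> sets borel \<Longrightarrow> A \<subseteq> - S' \<Longrightarrow> \<mu> A \<le> 0" using jordan_decomposition_carrier[OF J'] by metis
  \<comment> \<open>On \<open>A \<inter> T - U\<close> the value of \<mu> is at most 0, being
    outside \<open>U\<close>, and at least 0, being a value of the measure \<open>Q\<close>. So this
    part contributes nothing.\<close>
  have overlap: "measure Q A = \<mu> (A \<inter> T \<inter> U)"
    if A: "A \<in> sets borel" and T: "T \<in> sets borel" and U: "U \<in> sets borel"
      and Q: "\<And>A. A \<in> sets borel \<Longrightarrow> measure Q A = \<mu> (A \<inter> T)"
      and neg: "\<And>A. A \<in> sets borel \<Longrightarrow> A \<subseteq> - U \<Longrightarrow> \<mu> A \<le> 0" for Q A T U
  proof -
    have "\<mu> (A \<inter> T - U) \<le> 0" using A T U by (intro neg) auto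
    moreover have "\<mu> (A \<inter> T - U) = measure Q (A \<inter> T - U)"
      using A T U by (subst Q) (auto intro: arg_cong[of _ _ \<mu>])
    ultimately have "\<mu> (A \<inter> T - U) = 0" using measure_nonneg[of Q "A \<inter> T - U"] by linarith
    moreover have "\<mu> (A \<inter> T) = \<mu> (A \<inter> T \<inter> U) + \<mu> (A \<inter> T - U)"
      using signed_union[OF fin, of "A \<inter> T \<inter> U" "A \<inter> T - U"] A T U by (auto simp: Int_Diff_Un)
    ultimately show ?thesis using Q[OF A] by simp
  qed
  have eqP: "measure P A = measure P' A" if A: "A \<in> sets borel" for A
    using overlap[of A S S' P] overlap[of A S' S P'] A S S' by (simp add: Int_ac)
  have eqN: "measure N A = measure N' A" if "A \<in> sets borel" for A
    using J J' eqP[OF that] that unfolding jordan_decomposition_def by fastforce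
  have *: "finite_measure P" "finite_measure N" "finite_measure P'" "finite_measure N'"
    "sets P = sets borel" "sets N = sets borel" "sets P' = sets borel" "sets N' = sets borel"
    using J J' by (simp_all add: jordan_decomposition_def)
  show "P = P'" using * eqP by (intro measure_eqI) (simp_all add: finite_measure.emeasure_eq_measure)
  show "N = N'" using * eqN by (intro measure_eqI) (simp_all add: finite_measure.emeasure_eq_measure)
qed

text \<open>Existence and uniqueness together ensure that the definite descriptions behind
  \<open>pos_part\<close> and \<open>neg_part\<close> denote the Jordan parts.\<close>

lemma jordan_decomposition_pos_neg_part:
  assumes "finite_signed_measure \<mu>"
  shows "jordan_decomposition \<mu> (pos_part \<mu>) (neg_part \<mu>)"
proof -
  obtain P N where J: "jordan_decomposition \<mu> P N" using jordan_decomposition_exists[OF assms] .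
  have "pos_part \<mu> = P" "neg_part \<mu> = N"
    unfolding pos_part_def neg_part_def using J jordan_decomposition_unique[OF assms] by (auto intro!: the_equality)
  then show ?thesis using J by simp
qed

section \<open>The total variation as a finite measure\<close>

lemma sets_total_variation: "sets (total_variation \<mu>) = sets borel"
  using sets.sigma_sets_eq[of borel] by (simp add: total_variation_def)

lemma emeasure_total_variation:
  assumes \<mu>: "finite_signed_measure \<mu>" and A: "A \<in> sets borel"
  shows "emeasure (total_variation \<mu>) A = emeasure (pos_part \<mu>) A + emeasure (neg_part \<mu>) A"
  unfolding total_variation_def
proof (rule emeasure_measure_of_sigma)
  have sets: "sets (pos_part \<mu>) = sets borel" "sets (neg_part \<mu>) = sets borel"
    using jordan_decomposition_pos_neg_part[OF \<mu>] by (simp_all add: jordan_decomposition_def)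
  show "sigma_algebra UNIV (sets borel)" using sets.sigma_algebra_axioms[of borel] by simp
  show "positive (sets borel) (\<lambda>A. emeasure (pos_part \<mu>) A + emeasure (neg_part \<mu>) A)"
    by (simp add: positive_def)
  show "countably_additive (sets borel) (\<lambda>A. emeasure (pos_part \<mu>) A + emeasure (neg_part \<mu>) A)"
    unfolding countably_additive_def using sets by (simp add: suminf_add[symmetric] suminf_emeasure)
qed (fact A)

lemma finite_measure_total_variation:
  assumes \<mu>: "finite_signed_measure \<mu>"
  shows "finite_measure (total_variation \<mu>)"
proof
  have J: "jordan_decomposition \<mu> (pos_part \<mu>) (neg_part \<mu>)"
    by (rule jordan_decomposition_pos_neg_part[OF \<mu>])
  interpret P: finite_measure "pos_part \<mu>" using J by (simp add: jordan_decomposition_def)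
  interpret N: finite_measure "neg_part \<mu>" using J by (simp add: jordan_decomposition_def)
  have "space (total_variation \<mu>) = UNIV"
    using sets_total_variation by (metis sets_eq_imp_space_eq space_borel)
  then show "emeasure (total_variation \<mu>) (space (total_variation \<mu>)) \<noteq> \<infinity>"
    using emeasure_total_variation[OF \<mu>, of UNIV] by simp
qed

section \<open>Optimal couplings respect cuts of equal mass\<close>

text \<open>Convexity on the whole line forces continuity; measurability of the cost comes from
  here.\<close>

lemma strictly_convex_imp_borel_measurable:
  assumes "strictly_convex h"
  shows "h \<in> borel_measurable borel"
proof -
  have "convex_on UNIV h"
  proof (rule convex_onI)
    fix t x y :: real assume t: "0 < t" "t < 1"
    show "h ((1 - t) *\<^sub>R x + t *\<^sub>R y) \<le> (1 - t) * h x + t * h y"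
      using assms t unfolding strictly_convex_def
      by (cases "x = y") (force simp: algebra_simps intro: less_imp_le)+
  qed simp
  then show ?thesis by (intro borel_measurable_continuous_onI convex_on_continuous) auto
qed

text \<open>Uncrossing two pairs replaces the extreme displacements \<open>y' - x'\<close> and
  \<open>y - x\<close> by two intermediate ones with the same sum. These are convex combinations of
  the extremes with weights interchanged, so adding the two strict inequalities gives the
  claim.\<close>

lemma strictly_convex_swap:
  assumes h: "strictly_convex h" and "x < x'" "y' < y"
  shows "h (y' - x) + h (y - x') < h (y - x) + h (y' - x')"
proof -
  \<comment> \<open>Since \<open>u - l = (x' - x) + (y - y')\<close>, this \<open>t\<close> is the
    fraction of the way from \<open>l\<close> to \<open>u\<close> at which \<open>y' - x\<close>
    lies; \<open>y - x'\<close> lies at \<open>1 - t\<close>.\<close>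
  define l u t where "l = y' - x'" and "u = y - x" and "t = (x' - x) / ((x' - x) + (y - y'))"
  have t: "0 < t" "t < 1" and lu: "l \<noteq> u" using assms by (auto simp: t_def l_def u_def field_simps)
  have tul: "t * (u - l) = x' - x" using assms by (simp add: t_def l_def u_def field_simps)
  have "h ((1 - s) * l + s * u) < (1 - s) * h l + s * h u" if "0 < s" "s < 1" for s
    using h that lu unfolding strictly_convex_def by blast
  from this[of t] this[of "1 - t"] t
  have "h ((1 - t) * l + t * u) < (1 - t) * h l + t * h u"
    "h ((1 - (1 - t)) * l + (1 - t) * u) < (1 - (1 - t)) * h l + (1 - t) * h u" by auto
  moreover have "(1 - t) * l + t * u = l + t * (u - l)" "(1 - (1 - t)) * l + (1 - t) * u = u - t * (u - l)"
    by (simp_all add: algebra_simps)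
  moreover have "l + t * (u - l) = y' - x" "u - t * (u - l) = y - x'"
    by (simp_all only: tul) (simp_all add: l_def u_def)
  ultimately have "h (y' - x) < (1 - t) * h l + t * h u" "h (y - x') < (1 - (1 - t)) * h l + (1 - t) * h u"
    by metis+
  then show ?thesis by (simp add: l_def u_def algebra_simps)
qed

text \<open>The measure below replaces the parts \<open>A\<close> and \<open>B\<close> of \<open>\<gamma>\<close> by products of their marginals
  with partners exchanged.  It is obtained from \<open>\<gamma> \<Otimes> \<gamma>\<close>: the second point supplies the new partner
  if the first one lies in \<open>A \<union> B\<close>, and is irrelevant otherwise.\<close>

lemma exchange_partners:
  fixes \<gamma> :: "('a::second_countable_topology \<times> 'b::second_countable_topology) measure"
  assumes fin: "finite_measure \<gamma>" and sets: "sets \<gamma> = sets borel"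
    and A: "A \<in> sets borel" and B: "B \<in> sets borel" and AB: "A \<inter> B = {}"
    and mass: "emeasure \<gamma> A = emeasure \<gamma> B" and pos: "emeasure \<gamma> A \<noteq> 0"
  obtains \<gamma>' and k :: ennreal where "sets \<gamma>' = sets borel" "k \<noteq> 0" "k \<noteq> \<infinity>"
    "\<And>f. f \<in> borel_measurable borel \<Longrightarrow> (\<integral>\<^sup>+w. f w \<partial>\<gamma>) =
       (\<integral>\<^sup>+w. indicator (- (A \<union> B)) w * f w \<partial>\<gamma>) +
       k * (\<integral>\<^sup>+(v, w). indicator A v * indicator B w * (f v + f w) \<partial>(\<gamma> \<Otimes>\<^sub>M \<gamma>))"
    "\<And>f. f \<in> borel_measurable borel \<Longrightarrow> (\<integral>\<^sup>+w. f w \<partial>\<gamma>') =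
       (\<integral>\<^sup>+w. indicator (- (A \<union> B)) w * f w \<partial>\<gamma>) +
       k * (\<integral>\<^sup>+(v, w). indicator A v * indicator B w * (f (fst v, snd w) + f (fst w, snd v)) \<partial>(\<gamma> \<Otimes>\<^sub>M \<gamma>))"
proof -
  interpret finite_measure \<gamma> by fact
  interpret P: pair_sigma_finite \<gamma> \<gamma> ..
  note [measurable_cong] = sets
  note [measurable] = A B
  define \<phi> :: "('a \<times> 'b) \<times> ('a \<times> 'b) \<Rightarrow> 'a \<times> 'b"
    where "\<phi> = (\<lambda>(v, w). if v \<in> A \<union> B then (fst v, snd w) else v)"
  define m where "m = measure \<gamma> A"
  define T where "T = measure \<gamma> (space \<gamma>)"
  have m: "emeasure \<gamma> A = ennreal m" "emeasure \<gamma> B = ennreal m"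
    using mass by (simp_all add: m_def emeasure_eq_measure)
  have m_pos: "m > 0" using pos m by (metis ennreal_0 m_def measure_nonneg order_le_less)
  have "m \<le> T" unfolding m_def T_def by (rule bounded_measure)
  then have T_pos: "T > 0" using m_pos by simp
  have T: "emeasure \<gamma> (space \<gamma>) = ennreal T" by (simp add: T_def emeasure_eq_measure)
  \<comment> \<open>The weights compensate for the second point of a pair: a new partner is drawn
    from a set of mass \<open>m\<close>, whereas a point outside \<open>A \<union> B\<close> ignores
    a second point ranging over total mass \<open>T\<close>.\<close>
  define k where "k = ennreal (inverse m)"
  define k' where "k' = ennreal (inverse T)"
  have km: "k * ennreal m = 1" and kT: "k' * ennreal T = 1"
    using m_pos T_pos by (simp_all add: k_def k'_def ennreal_mult[symmetric])
  \<comment> \<open>The density keeps a pair if its first point needs no new partner, or if its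
    points lie in \<open>A\<close> and \<open>B\<close>, in either order; all other pairs get weight
    0.\<close>
  define d :: "('a \<times> 'b) \<times> ('a \<times> 'b) \<Rightarrow> ennreal"
    where "d = (\<lambda>(v, w). k' * indicator (- (A \<union> B)) v +
      k * (indicator A v * indicator B w + indicator B v * indicator A w))"
  have [measurable]: "fst \<in> \<gamma> \<rightarrow>\<^sub>M borel" "snd \<in> \<gamma> \<rightarrow>\<^sub>M borel" "(\<lambda>w. w) \<in> \<gamma> \<rightarrow>\<^sub>M borel"
    by (simp_all add: measurable_cong_sets[OF sets refl] borel_prod[symmetric])
  have \<phi>: "\<phi> \<in> \<gamma> \<Otimes>\<^sub>M \<gamma> \<rightarrow>\<^sub>M borel"
    unfolding \<phi>_def split_beta'
  proof (rule measurable_If)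
    show "(\<lambda>x. (fst (fst x), snd (snd x))) \<in> \<gamma> \<Otimes>\<^sub>M \<gamma> \<rightarrow>\<^sub>M borel"
      unfolding borel_prod[symmetric] by measurable
    show "fst \<in> \<gamma> \<Otimes>\<^sub>M \<gamma> \<rightarrow>\<^sub>M borel"
      using measurable_fst[of \<gamma> \<gamma>] by (simp add: measurable_cong_sets[OF refl sets])
    show "{x \<in> space (\<gamma> \<Otimes>\<^sub>M \<gamma>). fst x \<in> A \<union> B} \<in> sets (\<gamma> \<Otimes>\<^sub>M \<gamma>)"
      by measurable
  qed
  have d: "d \<in> borel_measurable (\<gamma> \<Otimes>\<^sub>M \<gamma>)" unfolding d_def by measurable
  define \<gamma>' where "\<gamma>' = distr (density (\<gamma> \<Otimes>\<^sub>M \<gamma>) d) borel \<phi>"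
  show ?thesis
  proof
    show "sets \<gamma>' = sets borel" by (simp add: \<gamma>'_def)
    show "k \<noteq> 0" "k \<noteq> \<infinity>" using m_pos by (simp_all add: k_def)
  next
    fix f :: "'a \<times> 'b \<Rightarrow> ennreal" assume f[measurable]: "f \<in> borel_measurable borel"
    \<comment> \<open>The integrand is a sum of terms that factor over the two points. Each yields
      the mass \<open>m\<close> of the other set, which \<open>k\<close> cancels.\<close>
    have "(\<integral>\<^sup>+(v, w). indicator A v * indicator B w * (f v + f w) \<partial>(\<gamma> \<Otimes>\<^sub>M \<gamma>))
      = (\<integral>\<^sup>+v. \<integral>\<^sup>+w. (indicator A v * f v) * indicator B w + indicator A v * (indicator B w * f w) \<partial>\<gamma> \<partial>\<gamma>)"
      by (subst nn_integral_fst[symmetric]) (auto simp: algebra_simps intro!: nn_integral_cong)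
    also have "\<dots> = (\<integral>\<^sup>+v. indicator A v * f v \<partial>\<gamma>) * ennreal m + ennreal m * (\<integral>\<^sup>+w. indicator B w * f w \<partial>\<gamma>)"
      by (simp add: nn_integral_add nn_integral_cmult nn_integral_multc m)
    finally have "k * (\<integral>\<^sup>+(v, w). indicator A v * indicator B w * (f v + f w) \<partial>(\<gamma> \<Otimes>\<^sub>M \<gamma>))
      = (k * ennreal m) * ((\<integral>\<^sup>+v. indicator A v * f v \<partial>\<gamma>) + (\<integral>\<^sup>+w. indicator B w * f w \<partial>\<gamma>))"
      by (simp add: algebra_simps)
    moreover have "(\<integral>\<^sup>+w. f w \<partial>\<gamma>) = (\<integral>\<^sup>+w. indicator (- (A \<union> B)) w * f w +
        (indicator A w * f w + indicator B w * f w) \<partial>\<gamma>)"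
      using AB by (intro nn_integral_cong) (auto split: split_indicator)
    ultimately show "(\<integral>\<^sup>+w. f w \<partial>\<gamma>) = (\<integral>\<^sup>+w. indicator (- (A \<union> B)) w * f w \<partial>\<gamma>) +
       k * (\<integral>\<^sup>+(v, w). indicator A v * indicator B w * (f v + f w) \<partial>(\<gamma> \<Otimes>\<^sub>M \<gamma>))"
      by (simp add: nn_integral_add km)
  next
    fix f :: "'a \<times> 'b \<Rightarrow> ennreal" assume f[measurable]: "f \<in> borel_measurable borel"
    have [measurable]: "(\<lambda>x. f (fst (fst x), snd (snd x))) \<in> borel_measurable (\<gamma> \<Otimes>\<^sub>M \<gamma>)"
      "(\<lambda>x. f (fst (snd x), snd (fst x))) \<in> borel_measurable (\<gamma> \<Otimes>\<^sub>M \<gamma>)"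
      by (rule measurable_compose[OF _ f], unfold borel_prod[symmetric], measurable)+
    define R where "R = (\<integral>\<^sup>+x. k' * indicator (- (A \<union> B)) (fst x) * f (fst x) \<partial>(\<gamma> \<Otimes>\<^sub>M \<gamma>))"
    define G where "G = (\<integral>\<^sup>+x. indicator A (fst x) * indicator B (snd x) * f (fst (fst x), snd (snd x)) \<partial>(\<gamma> \<Otimes>\<^sub>M \<gamma>))"
    define H where "H = (\<integral>\<^sup>+x. indicator B (fst x) * indicator A (snd x) * f (fst (fst x), snd (snd x)) \<partial>(\<gamma> \<Otimes>\<^sub>M \<gamma>))"
    have R_eq: "R = (\<integral>\<^sup>+w. indicator (- (A \<union> B)) w * f w \<partial>\<gamma>)"
    proof -
      have "R = (\<integral>\<^sup>+v. \<integral>\<^sup>+w. k' * indicator (- (A \<union> B)) v * f v \<partial>\<gamma> \<partial>\<gamma>)"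
        unfolding R_def by (subst nn_integral_fst[symmetric]) simp_all
      also have "\<dots> = (\<integral>\<^sup>+v. (k' * ennreal T) * (indicator (- (A \<union> B)) v * f v) \<partial>\<gamma>)"
        by (simp add: T mult_ac)
      finally show ?thesis by (simp add: kT)
    qed
    \<comment> \<open>Swapping the two copies of \<gamma> rewrites exchanges that start in
      \<open>B\<close> as exchanges that start in \<open>A\<close>, so both kinds become integrals
      over \<open>A \<times> B\<close>.\<close>
    have H_eq: "H = (\<integral>\<^sup>+x. indicator A (fst x) * indicator B (snd x) * f (fst (snd x), snd (fst x)) \<partial>(\<gamma> \<Otimes>\<^sub>M \<gamma>))"
      unfolding H_def
      by (subst P.distr_pair_swap, subst nn_integral_distr)
        (auto simp: split_beta' mult_ac intro!: nn_integral_cong)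
    have "(\<integral>\<^sup>+w. f w \<partial>\<gamma>') = (\<integral>\<^sup>+x. f (\<phi> x) \<partial>density (\<gamma> \<Otimes>\<^sub>M \<gamma>) d)"
      unfolding \<gamma>'_def
      by (rule nn_integral_distr)
        (simp_all only: measurable_cong_sets[OF sets_density refl] measurable_distr_eq1 \<phi> f)
    also have "\<dots> = (\<integral>\<^sup>+x. d x * f (\<phi> x) \<partial>(\<gamma> \<Otimes>\<^sub>M \<gamma>))"
      by (rule nn_integral_density[OF d measurable_compose[OF \<phi> f]])
    also have "\<dots> = (\<integral>\<^sup>+x. k' * indicator (- (A \<union> B)) (fst x) * f (fst x) +
        (k * (indicator A (fst x) * indicator B (snd x) * f (fst (fst x), snd (snd x))) +
         k * (indicator B (fst x) * indicator A (snd x) * f (fst (fst x), snd (snd x)))) \<partial>(\<gamma> \<Otimes>\<^sub>M \<gamma>))"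
    proof (rule nn_integral_cong)
      fix x :: "('a \<times> 'b) \<times> ('a \<times> 'b)"
      consider "fst x \<in> A" "fst x \<notin> B" | "fst x \<notin> A" "fst x \<in> B" | "fst x \<notin> A" "fst x \<notin> B"
        using AB by blast
      then show "d x * f (\<phi> x) = k' * indicator (- (A \<union> B)) (fst x) * f (fst x) +
        (k * (indicator A (fst x) * indicator B (snd x) * f (fst (fst x), snd (snd x))) +
         k * (indicator B (fst x) * indicator A (snd x) * f (fst (fst x), snd (snd x))))"
        by cases (simp_all add: d_def \<phi>_def split_beta' mult_ac)
    qed
    also have "\<dots> = R + (k * G + k * H)"
      unfolding R_def G_def H_def
      by (subst nn_integral_add; (subst nn_integral_add)?; (subst nn_integral_cmult)?; (subst nn_integral_cmult)?) simp_all
    also have "k * G + k * H = k * (G + H)"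
      by (simp add: distrib_left)
    also have "G + H = (\<integral>\<^sup>+(v, w). indicator A v * indicator B w *
        (f (fst v, snd w) + f (fst w, snd v)) \<partial>(\<gamma> \<Otimes>\<^sub>M \<gamma>))"
      unfolding G_def H_eq
      by (subst nn_integral_add[symmetric]) (simp_all add: distrib_left split_beta')
    finally show "(\<integral>\<^sup>+w. f w \<partial>\<gamma>') = (\<integral>\<^sup>+w. indicator (- (A \<union> B)) w * f w \<partial>\<gamma>) +
       k * (\<integral>\<^sup>+(v, w). indicator A v * indicator B w * (f (fst v, snd w) + f (fst w, snd v)) \<partial>(\<gamma> \<Otimes>\<^sub>M \<gamma>))"
      unfolding R_eq .
  qed
qed

text \<open>\<open>L\<close> and \<open>M\<close> are arbitrary initial segments of the line,
  possibly empty or everything, so that infinite partition points fit the same statement.\<close>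

lemma optimal_coupling_preserves_cut:
  fixes L M :: "real set"
  assumes h: "strictly_convex h" "\<And>x. h x \<ge> 0" and c: "\<And>x y. c x y = h (y - x)"
    and opt: "optimal_coupling c \<alpha> \<beta> \<gamma>"
    and fin: "finite_measure \<alpha>" and cost: "(\<integral>\<^sup>+(x, y). ennreal (c x y) \<partial>\<gamma>) \<noteq> \<infinity>"
    and L: "L \<in> sets borel" "\<And>x x'. x \<in> L \<Longrightarrow> x' \<notin> L \<Longrightarrow> x < x'"
    and M: "M \<in> sets borel" "\<And>y y'. y \<in> M \<Longrightarrow> y' \<notin> M \<Longrightarrow> y < y'"
    and mass: "emeasure \<alpha> L = emeasure \<beta> M"
  shows "AE w in \<gamma>. fst w \<in> L \<longleftrightarrow> snd w \<in> M"
proof -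
  have cp: "coupling \<alpha> \<beta> \<gamma>" using opt by (simp add: optimal_coupling_def)
  then have sets: "sets \<gamma> = sets borel" and \<alpha>: "distr \<gamma> borel fst = \<alpha>" and \<beta>: "distr \<gamma> borel snd = \<beta>"
    by (simp_all add: coupling_def)
  have space: "space \<gamma> = UNIV" using sets by (metis sets_eq_imp_space_eq space_borel)
  note [measurable_cong] = sets
  note [measurable] = L(1) M(1) strictly_convex_imp_borel_measurable[OF h(1)]
  have [measurable]: "fst \<in> \<gamma> \<rightarrow>\<^sub>M borel" "snd \<in> \<gamma> \<rightarrow>\<^sub>M borel"
    using sets by (simp_all add: measurable_cong_sets[OF sets refl] borel_prod[symmetric])
  interpret finite_measure \<gamma>
  proof
    have "emeasure \<gamma> (space \<gamma>) = emeasure \<alpha> (space \<alpha>)"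
      unfolding \<alpha>[symmetric] by (simp add: emeasure_distr)
    then show "emeasure \<gamma> (space \<gamma>) \<noteq> \<infinity>" using finite_measure.emeasure_finite[OF fin] by simp
  qed
  define A where "A = {w. fst w \<in> L \<and> snd w \<notin> M}"
  define B where "B = {w. fst w \<notin> L \<and> snd w \<in> M}"
  define D where "D = {w. fst w \<in> L \<and> snd w \<in> M}"
  have "A = {w \<in> space \<gamma>. fst w \<in> L \<and> snd w \<notin> M}" "B = {w \<in> space \<gamma>. fst w \<notin> L \<and> snd w \<in> M}"
    "D = {w \<in> space \<gamma>. fst w \<in> L \<and> snd w \<in> M}"
    by (auto simp: A_def B_def D_def space)
  then have AB\<gamma>: "A \<in> sets \<gamma>" "B \<in> sets \<gamma>" "D \<in> sets \<gamma>" by simp_all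
  then have AB[measurable]: "A \<in> sets borel" "B \<in> sets borel" by (simp_all add: sets)
  \<comment> \<open>\<open>A\<close> and \<open>B\<close> are the two ways of crossing the cut, and
    \<open>D\<close> stays below it. Equal masses below the cut give \<gamma> the same total on
    \<open>A\<close> and \<open>D\<close> as on \<open>B\<close> and \<open>D\<close>; as \<gamma>
    is finite, \<open>D\<close> cancels.\<close>
  have "measure \<gamma> A + measure \<gamma> D = measure \<alpha> L"
  proof -
    have "measure \<alpha> L = measure \<gamma> (A \<union> D)"
      unfolding \<alpha>[symmetric] by (auto simp: measure_distr A_def D_def space intro!: arg_cong[of _ _ "measure \<gamma>"])
    then show ?thesis using AB\<gamma> by (subst (asm) finite_measure_Union) (auto simp: A_def D_def)
  qed
  moreover have "measure \<gamma> B + measure \<gamma> D = measure \<beta> M"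
  proof -
    have "measure \<beta> M = measure \<gamma> (B \<union> D)"
      unfolding \<beta>[symmetric] by (auto simp: measure_distr B_def D_def space intro!: arg_cong[of _ _ "measure \<gamma>"])
    then show ?thesis using AB\<gamma> by (subst (asm) finite_measure_Union) (auto simp: B_def D_def)
  qed
  ultimately have ABm: "emeasure \<gamma> A = emeasure \<gamma> B"
    using arg_cong[OF mass, of enn2real] by (simp add: emeasure_eq_measure flip: measure_def)
  have "emeasure \<gamma> A = 0"
  proof (rule ccontr)
    assume pos: "emeasure \<gamma> A \<noteq> 0"
    have disj: "A \<inter> B = {}" by (auto simp: A_def B_def)
    obtain \<gamma>' and k :: ennreal where \<gamma>': "sets \<gamma>' = sets borel" and k: "k \<noteq> 0" "k \<noteq> \<infinity>"
      and int: "\<And>f. f \<in> borel_measurable borel \<Longrightarrow> (\<integral>\<^sup>+w. f w \<partial>\<gamma>) =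
       (\<integral>\<^sup>+w. indicator (- (A \<union> B)) w * f w \<partial>\<gamma>) +
       k * (\<integral>\<^sup>+(v, w). indicator A v * indicator B w * (f v + f w) \<partial>(\<gamma> \<Otimes>\<^sub>M \<gamma>))"
      and int': "\<And>f. f \<in> borel_measurable borel \<Longrightarrow> (\<integral>\<^sup>+w. f w \<partial>\<gamma>') =
       (\<integral>\<^sup>+w. indicator (- (A \<union> B)) w * f w \<partial>\<gamma>) +
       k * (\<integral>\<^sup>+(v, w). indicator A v * indicator B w * (f (fst v, snd w) + f (fst w, snd v)) \<partial>(\<gamma> \<Otimes>\<^sub>M \<gamma>))"
      by (rule exchange_partners[OF finite_measure_axioms sets AB disj ABm pos]) (rule that; assumption)
    note [measurable_cong] = \<gamma>'
    have [measurable]: "fst \<in> \<gamma>' \<rightarrow>\<^sub>M borel" "snd \<in> \<gamma>' \<rightarrow>\<^sub>M borel"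
      using \<gamma>' by (simp_all add: measurable_cong_sets[OF \<gamma>' refl] borel_prod[symmetric])
    have [measurable]: "(fst :: real \<times> real \<Rightarrow> real) \<in> borel \<rightarrow>\<^sub>M borel"
      "(snd :: real \<times> real \<Rightarrow> real) \<in> borel \<rightarrow>\<^sub>M borel"
      by (simp_all add: borel_prod[symmetric])
    \<comment> \<open>For \<open>f\<close> depending on one coordinate only, exchanging partners
      merely permutes the terms of \<open>f v + f w\<close>, so the two integral formulas
      coincide.\<close>
    have marg: "distr \<gamma>' borel p = distr \<gamma> borel p"
      if p: "p = fst \<or> p = snd" for p :: "real \<times> real \<Rightarrow> real"
    proof (rule measure_eqI)
      fix U assume "U \<in> sets (distr \<gamma>' borel p)"
      then have [measurable]: "U \<in> sets borel" by simp
      have [measurable]: "p \<in> \<gamma>' \<rightarrow>\<^sub>M borel" "p \<in> \<gamma> \<rightarrow>\<^sub>M borel" "p \<in> borel \<rightarrow>\<^sub>M borel" using p by auto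
      define f :: "real \<times> real \<Rightarrow> ennreal" where "f = (\<lambda>w. indicator U (p w))"
      have f: "f \<in> borel_measurable borel" unfolding f_def by measurable
      have "f (fst v, snd w) + f (fst w, snd v) = f v + f w" for v w
        using p by (auto simp: f_def add.commute)
      then have "(\<integral>\<^sup>+w. f w \<partial>\<gamma>') = (\<integral>\<^sup>+w. f w \<partial>\<gamma>)" by (simp only: int[OF f] int'[OF f])
      moreover have "(\<integral>\<^sup>+w. f w \<partial>\<mu>) = emeasure (distr \<mu> borel p) U" if [measurable]: "p \<in> \<mu> \<rightarrow>\<^sub>M borel" for \<mu>
      proof -
        have "(\<integral>\<^sup>+w. f w \<partial>\<mu>) = (\<integral>\<^sup>+x. indicator U x \<partial>distr \<mu> borel p)"
          unfolding f_def by (subst nn_integral_distr) simp_all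
        then show ?thesis by simp
      qed
      ultimately show "emeasure (distr \<gamma>' borel p) U = emeasure (distr \<gamma> borel p) U" by force
    qed simp
    then have "coupling \<alpha> \<beta> \<gamma>'" using cp \<gamma>' by (simp add: coupling_def)
    then have le: "(\<integral>\<^sup>+(x, y). ennreal (c x y) \<partial>\<gamma>) \<le> (\<integral>\<^sup>+(x, y). ennreal (c x y) \<partial>\<gamma>')"
      using opt by (simp add: optimal_coupling_def)
    define f where "f = (\<lambda>(x, y). ennreal (c x y))"
    have f[measurable]: "f \<in> borel_measurable borel"
      unfolding f_def c borel_prod[symmetric] by measurable
    \<comment> \<open>A point of \<open>A\<close> starts to the left of a point of \<open>B\<close>
      and ends to its right, so the pairs cross and the swap is strictly cheaper.\<close>
    have f_swap: "f (fst v, snd w) + f (fst w, snd v) < f v + f w" if "v \<in> A" "w \<in> B" for v w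
    proof -
      have "h (snd w - fst v) + h (snd v - fst w) < h (snd v - fst v) + h (snd w - fst w)"
        using that by (intro strictly_convex_swap[OF h(1)] L M) (auto simp: A_def B_def)
      then show ?thesis
        using h(2) by (simp add: f_def c split_beta ennreal_plus[symmetric] ennreal_less_iff del: ennreal_plus)
    qed
    let ?R = "\<integral>\<^sup>+w. indicator (- (A \<union> B)) w * f w \<partial>\<gamma>"
    let ?F = "\<lambda>(v, w). indicator A v * indicator B w * (f v + f w)"
    let ?G = "\<lambda>(v, w). indicator A v * indicator B w * (f (fst v, snd w) + f (fst w, snd v))"
    have F[measurable]: "?F \<in> borel_measurable (\<gamma> \<Otimes>\<^sub>M \<gamma>)" by measurable
    have G[measurable]: "?G \<in> borel_measurable (\<gamma> \<Otimes>\<^sub>M \<gamma>)"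
      using f unfolding borel_prod[symmetric] by measurable
    have GF: "?G x \<le> ?F x" for x using f_swap by (auto split: split_indicator prod.split intro: less_imp_le)
    have eq: "?R + k * integral\<^sup>N (\<gamma> \<Otimes>\<^sub>M \<gamma>) ?F \<le> ?R + k * integral\<^sup>N (\<gamma> \<Otimes>\<^sub>M \<gamma>) ?G"
      using le int[OF f] int'[OF f] by (simp add: f_def)
    \<comment> \<open>Finite cost permits cancelling the common part \<open>?R\<close>, and
      \<open>k\<close> is neither 0 nor infinite. Optimality thus becomes an inequality between the
      integrals over the exchanged pairs, opposite to the strict one shown next.\<close>
    have fin: "?R + k * integral\<^sup>N (\<gamma> \<Otimes>\<^sub>M \<gamma>) ?F \<noteq> \<infinity>" using cost int[OF f] by (simp add: f_def)
    then have "?R \<noteq> \<infinity>" and fin': "integral\<^sup>N (\<gamma> \<Otimes>\<^sub>M \<gamma>) ?F \<noteq> \<infinity>"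
      using k by (auto simp: ennreal_mult_eq_top_iff)
    then have FG: "integral\<^sup>N (\<gamma> \<Otimes>\<^sub>M \<gamma>) ?F \<le> integral\<^sup>N (\<gamma> \<Otimes>\<^sub>M \<gamma>) ?G"
      using eq k by (simp add: ennreal_add_left_cancel_le ennreal_mult_le_mult_iff)
    have "integral\<^sup>N (\<gamma> \<Otimes>\<^sub>M \<gamma>) ?G < integral\<^sup>N (\<gamma> \<Otimes>\<^sub>M \<gamma>) ?F"
    proof (rule nn_integral_less[OF G F])
      show "integral\<^sup>N (\<gamma> \<Otimes>\<^sub>M \<gamma>) ?G \<noteq> \<infinity>"
        using nn_integral_mono[of "\<gamma> \<Otimes>\<^sub>M \<gamma>" ?G ?F] GF fin' by (auto simp: top_unique)
      show "AE x in \<gamma> \<Otimes>\<^sub>M \<gamma>. ?G x \<le> ?F x" using GF by simp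
      \<comment> \<open>Strictness at every point of \<open>A \<times> B\<close> would force this
        product to be null, but its mass is the product of two positive masses.\<close>
      show "\<not> (AE x in \<gamma> \<Otimes>\<^sub>M \<gamma>. ?F x \<le> ?G x)"
      proof
        assume "AE x in \<gamma> \<Otimes>\<^sub>M \<gamma>. ?F x \<le> ?G x"
        then have "AE x in \<gamma> \<Otimes>\<^sub>M \<gamma>. x \<notin> A \<times> B"
          by eventually_elim (use f_swap in \<open>auto simp: not_le[symmetric]\<close>)
        then have "emeasure (\<gamma> \<Otimes>\<^sub>M \<gamma>) (A \<times> B) = 0"
          by (subst (asm) AE_iff_measurable[of "A \<times> B"]) (use AB\<gamma> in \<open>auto simp: space_pair_measure space\<close>)
        then show False using pos ABm AB\<gamma> by (simp add: emeasure_pair_measure_Times)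
      qed
    qed
    then show False using FG by simp
  qed
  then have "A \<in> null_sets \<gamma>" "B \<in> null_sets \<gamma>" using ABm AB\<gamma> by auto
  then have "AE w in \<gamma>. w \<notin> A" "AE w in \<gamma>. w \<notin> B" by (auto intro: AE_not_in)
  then show ?thesis by eventually_elim (auto simp: A_def B_def)
qed

section \<open>Signatures and total variation\<close>

text \<open>With \<open>I\<close> the indices of the positive, respectively negative, entries of a
  signature, this set carries the positive, respectively negative, part.\<close>

definition signature_support :: "(nat \<Rightarrow> ereal) \<Rightarrow> nat set \<Rightarrow> real set" where
  "signature_support p I = (\<Union>i\<in>I. signature_interval p i)"

section \<open>Signature intervals as a partition of the line\<close>

lemma signature_interval_borel [measurable]: "signature_interval p i \<in> sets borel"
proof -
  have "{x \<in> space borel. p i < ereal x \<and> ereal x \<le> p (Suc i)} \<in> sets borel" by measurable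
  then show ?thesis by (simp add: signature_interval_def)
qed

lemma signature_support_borel [measurable]: "finite I \<Longrightarrow> signature_support p I \<in> sets borel"
  unfolding signature_support_def by (intro sets.finite_UN) (auto simp: signature_interval_borel)

lemma partition_points_mono:
  assumes "\<And>i. i < n \<Longrightarrow> p i < p (Suc i)" "i \<le> j" "j \<le> n"
  shows "p i \<le> (p j :: ereal)"
  using assms(2,3)
proof (induction rule: dec_induct)
  case (step k)
  then show ?case using assms(1)[of k] by (meson Suc_le_lessD Suc_leD less_imp_le order_trans)
qed simp

lemma signature_interval_disjoint:
  assumes "\<And>i. i < n \<Longrightarrow> p i < p (Suc i)" "i < n" "j < n" "i \<noteq> j"
  shows "signature_interval p i \<inter> signature_interval p j = {}"
proof -
  have *: "signature_interval p i \<inter> signature_interval p j = {}" if "i < j" "j < n" for i j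
    using partition_points_mono[of n p "Suc i" j] assms(1) that
    by (fastforce simp: signature_interval_def)
  then show ?thesis using assms by (metis Int_commute linorder_neqE_nat)
qed

lemma signature_interval_cover:
  assumes "p 0 = -\<infinity>" "p n = (\<infinity> :: ereal)"
  obtains i where "i < n" "x \<in> signature_interval p i"
proof -
  \<comment> \<open>The first partition point at or above \<open>x\<close> closes the interval
    containing \<open>x\<close>. It is not \<open>p 0\<close>, which is minus infinity, so its index
    has a predecessor \<open>i\<close>.\<close>
  define k where "k = (LEAST k. ereal x \<le> p k)"
  have k: "ereal x \<le> p k" "k \<le> n" unfolding k_def using assms(2)
    by (auto intro!: LeastI[of "\<lambda>k. ereal x \<le> p k" n] Least_le)
  then obtain i where i: "k = Suc i" using assms(1) by (cases k) auto
  then have "\<not> ereal x \<le> p i" using not_less_Least[of i "\<lambda>k. ereal x \<le> p k"] by (simp add: k_def)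
  then show ?thesis using that[of i] k i by (auto simp: signature_interval_def)
qed

lemma emeasure_signature_split:
  assumes p: "p 0 = -\<infinity>" "p n = \<infinity>" "\<And>i. i < n \<Longrightarrow> p i < p (Suc i)"
    and M: "sets M = sets borel" and A: "A \<in> sets borel"
  shows "emeasure M A = (\<Sum>i<n. emeasure M (A \<inter> signature_interval p i))"
proof -
  have "(\<Union>i<n. A \<inter> signature_interval p i) = A"
    using signature_interval_cover[OF p(1,2)] by blast
  moreover have "(\<Sum>i<n. emeasure M (A \<inter> signature_interval p i)) =
      emeasure M (\<Union>i<n. A \<inter> signature_interval p i)"
  proof (rule sum_emeasure)
    show "(\<lambda>i. A \<inter> signature_interval p i) ` {..<n} \<subseteq> sets M" 
      unfolding M by (intro image_subsetI sets.Int A signature_interval_borel)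
    show "disjoint_family_on (\<lambda>i. A \<inter> signature_interval p i) {..<n}"
    proof (rule disjoint_family_on_bisimulation)
      show "disjoint_family_on (signature_interval p) {..<n}"
        unfolding disjoint_family_on_def
        by (intro ballI impI signature_interval_disjoint[of n] p(3)) simp_all
    qed auto
  qed simp
  ultimately show ?thesis by simp
qed

text \<open>Since the pieces of a signature are one-signed, the sign of the entry \<open>z ! i\<close> decides which
  Jordan part lives on the \<open>i\<close>-th interval; where \<open>z ! i = 0\<close>, both vanish.\<close>

lemma has_signature_total_variation:
  assumes sig: "has_signature a z"
  obtains p where "p 0 = -\<infinity>" "p (length z) = \<infinity>" "\<And>i. i < length z \<Longrightarrow> p i < p (Suc i)"
    "\<And>i. i < length z \<Longrightarrow> emeasure (total_variation a) (signature_interval p i) = ennreal \<bar>z ! i\<bar>"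
    "\<And>A. A \<in> sets borel \<Longrightarrow> emeasure (pos_part a) A =
       emeasure (total_variation a) (A \<inter> signature_support p {i. i < length z \<and> z ! i > 0})"
    "\<And>A. A \<in> sets borel \<Longrightarrow> emeasure (neg_part a) A =
       emeasure (total_variation a) (A \<inter> signature_support p {i. i < length z \<and> z ! i < 0})"
proof -
  let ?n = "length z" and ?P = "pos_part a" and ?N = "neg_part a" and ?V = "total_variation a"
  from sig obtain p ai \<sigma> where p01: "p 0 = -\<infinity>" "p ?n = \<infinity>"
    and "\<forall>i<?n. p i < p (Suc i)"
    and "\<forall>A\<in>sets borel. a A = (\<Sum>i<?n. ai i A)"
    and "\<forall>i<?n. \<forall>A\<in>sets borel.
      ai i A = (if \<sigma> i then measure ?P (A \<inter> signature_interval p i)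
                else - measure ?N (A \<inter> signature_interval p i))"
    and "\<forall>i<?n. z ! i = a (signature_interval p i)"
    unfolding has_signature_def by (elim conjE exE) (rule that; assumption)
  note p = p01 this(3)[rule_format] and a = this(4)[rule_format]
    and ai = this(5)[rule_format] and z = this(6)[rule_format]
  have fin: "finite_signed_measure a" using sig by (simp add: has_signature_def)
  have J: "jordan_decomposition a ?P ?N" by (rule jordan_decomposition_pos_neg_part[OF fin])
  interpret P: finite_measure ?P using J by (simp add: jordan_decomposition_def)
  interpret N: finite_measure ?N using J by (simp add: jordan_decomposition_def)
  have sets: "sets ?P = sets borel" "sets ?N = sets borel"
    and aPN: "\<And>A. A \<in> sets borel \<Longrightarrow> a A = measure ?P A - measure ?N A"
    using J by (simp_all add: jordan_decomposition_def)
  let ?I = "signature_interval p"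
  note V = emeasure_total_variation[OF fin]
  have piece: "a (A \<inter> ?I i) = (if \<sigma> i then measure ?P (A \<inter> ?I i) else - measure ?N (A \<inter> ?I i))"
    if i: "i < ?n" and A: "A \<in> sets borel" for i A
  proof -
    have "ai j (A \<inter> ?I i) = 0" if j: "j < ?n" "j \<noteq> i" for j
    proof -
      have "A \<inter> ?I i \<inter> ?I j = {}" using signature_interval_disjoint[of ?n p i j] p(3) i j by blast
      then show ?thesis using ai[OF j(1), of "A \<inter> ?I i"] A by simp
    qed
    then have "(\<Sum>j\<in>{..<?n} - {i}. ai j (A \<inter> ?I i)) = 0" by (intro sum.neutral) simp
    moreover have "a (A \<inter> ?I i) = (\<Sum>j<?n. ai j (A \<inter> ?I i))" using A by (intro a) simp
    ultimately have "a (A \<inter> ?I i) = ai i (A \<inter> ?I i)"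
      using sum.remove[of "{..<?n}" i "\<lambda>j. ai j (A \<inter> ?I i)"] i by simp
    then show ?thesis using ai[OF i, of "A \<inter> ?I i"] A by (simp add: Int_assoc)
  qed
  have N0: "emeasure ?N (A \<inter> ?I i) = 0" if "i < ?n" "\<sigma> i" "A \<in> sets borel" for i A
    using piece[of i A] aPN[of "A \<inter> ?I i"] that by (simp add: N.emeasure_eq_measure)
  have P0: "emeasure ?P (A \<inter> ?I i) = 0" if "i < ?n" "\<not> \<sigma> i" "A \<in> sets borel" for i A
    using piece[of i A] aPN[of "A \<inter> ?I i"] that by (simp add: P.emeasure_eq_measure)
  have zP: "emeasure ?P (?I i) = ennreal (z ! i)" "z ! i \<ge> 0" if "i < ?n" "\<sigma> i" for i
    using piece[of i UNIV] z[of i] that by (simp_all add: P.emeasure_eq_measure)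
  have zN: "emeasure ?N (?I i) = ennreal (- z ! i)" "z ! i \<le> 0" if "i < ?n" "\<not> \<sigma> i" for i
    using piece[of i UNIV] z[of i] that by (simp_all add: N.emeasure_eq_measure)
  have VI: "emeasure ?V (?I i) = ennreal \<bar>z ! i\<bar>" if "i < ?n" for i
    using that V[of "?I i"] N0[of i UNIV] P0[of i UNIV] zP[of i] zN[of i] by (cases "\<sigma> i") simp_all
  have null: "emeasure M (A \<inter> ?I i) = 0" if "emeasure M (?I i) = 0" "sets M = sets borel" for M A i
    by (rule emeasure_eq_0[OF _ that(1)]) (simp_all add: that(2) signature_interval_borel)
  have P_piece: "emeasure ?P (A \<inter> ?I i) = (if z ! i > 0 then emeasure ?V (A \<inter> ?I i) else 0)"
    if i: "i < ?n" and A: "A \<in> sets borel" for i A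
  proof (cases "\<sigma> i")
    case True
    have "emeasure ?P (A \<inter> ?I i) = 0" if "\<not> z ! i > 0"
      using zP[OF i True] that by (intro null sets(1)) (simp add: ennreal_neg)
    then show ?thesis using i A True N0[of i A] V[of "A \<inter> ?I i"] by simp
  next
    case False
    then show ?thesis using i A P0[of i A] zN(2)[of i] by simp
  qed
  have N_piece: "emeasure ?N (A \<inter> ?I i) = (if z ! i < 0 then emeasure ?V (A \<inter> ?I i) else 0)"
    if i: "i < ?n" and A: "A \<in> sets borel" for i A
  proof (cases "\<sigma> i")
    case True
    then show ?thesis using i A N0[of i A] zP(2)[of i] by simp
  next
    case False
    have "emeasure ?N (A \<inter> ?I i) = 0" if "\<not> z ! i < 0"
      using zN[OF i False] that by (intro null sets(2)) (simp add: ennreal_neg)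
    then show ?thesis using i A False P0[of i A] V[of "A \<inter> ?I i"] by simp
  qed
  have collect: "emeasure M A = emeasure ?V (A \<inter> signature_support p {i. i < ?n \<and> Q i})"
    if M: "sets M = sets borel" and A: "A \<in> sets borel"
      and pieces: "\<And>i. i < ?n \<Longrightarrow> emeasure M (A \<inter> ?I i) = (if Q i then emeasure ?V (A \<inter> ?I i) else 0)"
    for M A Q
  proof -
    have S: "A \<inter> signature_support p {i. i < ?n \<and> Q i} \<in> sets borel"
      using A by (intro sets.Int signature_support_borel) auto
    have "A \<inter> signature_support p {i. i < ?n \<and> Q i} \<inter> ?I i = (if Q i then A \<inter> ?I i else {})"
      if "i < ?n" for i
    proof -
      have "?I j \<inter> ?I i = {}" if "j < ?n" "j \<noteq> i" for j
        using signature_interval_disjoint[of ?n p j i] p(3) that \<open>i < ?n\<close> by blast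
      then have "\<not> Q i \<Longrightarrow> signature_support p {i. i < ?n \<and> Q i} \<inter> ?I i = {}"
        unfolding signature_support_def by blast
      moreover have "Q i \<Longrightarrow> ?I i \<subseteq> signature_support p {i. i < ?n \<and> Q i}"
        using \<open>i < ?n\<close> unfolding signature_support_def by blast
      ultimately show ?thesis by (simp add: Int_assoc Int_absorb1)
    qed
    then show ?thesis
      using emeasure_signature_split[OF p M A] emeasure_signature_split[OF p sets_total_variation S, of a] pieces
      by (auto intro!: sum.cong)
  qed
  show ?thesis
    by (rule that[OF p VI collect[OF sets(1) _ P_piece] collect[OF sets(2) _ N_piece]])
qed

lemma emeasure_lower_signature_interval:
  assumes p: "p 0 = -\<infinity>" "\<And>i. i < n \<Longrightarrow> p i < p (Suc i)"
    and M: "sets M = sets borel" and k: "k \<le> n"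
  shows "emeasure M {x. ereal x \<le> p k} = (\<Sum>i<k. emeasure M (signature_interval p i))"
  using k
proof (induction k)
  case 0
  then show ?case using p(1) by simp
next
  case (Suc k)
  have borel: "{x. ereal x \<le> p k} \<in> sets borel"
  proof -
    have "{x \<in> space borel. ereal x \<le> p k} \<in> sets borel" by measurable
    then show ?thesis by simp
  qed
  have "p k < p (Suc k)" using p(2) Suc.prems by simp
  then have "{x. ereal x \<le> p (Suc k)} = {x. ereal x \<le> p k} \<union> signature_interval p k"
    by (auto simp: signature_interval_def not_le)
  moreover have "{x. ereal x \<le> p k} \<inter> signature_interval p k = {}"
    by (auto simp: signature_interval_def)
  ultimately show ?case
    using Suc M borel by (simp add: plus_emeasure[symmetric])
qed

lemma signed_RN_deriv_supports:
  fixes \<alpha> :: "real measure"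
  assumes fin: "finite_measure \<alpha>" and \<alpha>: "sets \<alpha> = sets borel"
    and sets: "sets (pos_part a) = sets borel" "sets (neg_part a) = sets borel"
    and S: "S \<in> sets borel" "\<And>A. A \<in> sets borel \<Longrightarrow> emeasure (pos_part a) A = emeasure \<alpha> (A \<inter> S)"
    and T: "T \<in> sets borel" "\<And>A. A \<in> sets borel \<Longrightarrow> emeasure (neg_part a) A = emeasure \<alpha> (A \<inter> T)"
  shows "AE x in \<alpha>. signed_RN_deriv \<alpha> a x = indicator S x - indicator T x"
proof -
  interpret finite_measure \<alpha> by fact
  have *: "AE x in \<alpha>. indicator S x = RN_deriv \<alpha> P x"
    if "sets P = sets borel" and S: "S \<in> sets borel"
      and "\<And>A. A \<in> sets borel \<Longrightarrow> emeasure P A = emeasure \<alpha> (A \<inter> S)" for P S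
  proof (rule RN_deriv_unique)
    show ind: "indicator S \<in> borel_measurable \<alpha>" using S \<alpha> by simp
    show "density \<alpha> (indicator S) = P"
    proof (rule measure_eqI)
      fix A assume "A \<in> sets (density \<alpha> (indicator S))"
      then have A: "A \<in> sets borel" using \<alpha> by simp
      have "emeasure (density \<alpha> (indicator S)) A = (\<integral>\<^sup>+x. indicator (A \<inter> S) x \<partial>\<alpha>)"
        using A \<alpha> ind by (subst emeasure_density) (auto intro!: nn_integral_cong split: split_indicator)
      then show "emeasure (density \<alpha> (indicator S)) A = emeasure P A"
        using that A \<alpha> by simp
    qed (use that \<alpha> in simp)
  qed
  have "AE x in \<alpha>. indicator S x = RN_deriv \<alpha> (pos_part a) x"
    "AE x in \<alpha>. indicator T x = RN_deriv \<alpha> (neg_part a) x" using * sets S T by blast+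
  then show ?thesis
  proof eventually_elim
    case (elim x)
    show ?case unfolding signed_RN_deriv_def elim[symmetric] by (simp split: split_indicator)
  qed
qed

section \<open>Transport between equal signatures\<close>

lemma coupling_measurable:
  assumes "coupling \<alpha> \<beta> \<gamma>"
  shows "fst \<in> \<gamma> \<rightarrow>\<^sub>M borel" "snd \<in> \<gamma> \<rightarrow>\<^sub>M borel"
proof -
  have s: "sets \<gamma> = sets borel" using assms by (simp add: coupling_def)
  show "fst \<in> \<gamma> \<rightarrow>\<^sub>M borel" "snd \<in> \<gamma> \<rightarrow>\<^sub>M borel"
    by (simp_all add: measurable_cong_sets[OF s refl] borel_prod[symmetric])
qed

lemma coupling_cost_finite:
  assumes cp: "coupling \<alpha> \<beta> \<gamma>" and c: "\<And>x y. c x y \<le> cX x + cY y"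
    and X: "integrable \<alpha> cX" and Y: "integrable \<beta> cY"
  shows "(\<integral>\<^sup>+(x, y). ennreal (c x y) \<partial>\<gamma>) \<noteq> \<infinity>"
proof -
  note m = coupling_measurable[OF cp]
  have \<alpha>: "\<alpha> = distr \<gamma> borel fst" and \<beta>: "\<beta> = distr \<gamma> borel snd" using cp by (simp_all add: coupling_def)
  have "cX \<in> borel_measurable borel" "cY \<in> borel_measurable borel"
    using borel_measurable_integrable[OF X] borel_measurable_integrable[OF Y] by (simp_all add: \<alpha> \<beta>)
  then have "integrable \<gamma> (\<lambda>w. cX (fst w))" "integrable \<gamma> (\<lambda>w. cY (snd w))"
    using X Y m by (simp_all add: \<alpha> \<beta> integrable_distr_eq)
  then have int: "integrable \<gamma> (\<lambda>w. cX (fst w) + cY (snd w))" by (rule Bochner_Integration.integrable_add)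
  have "(\<integral>\<^sup>+(x, y). ennreal (c x y) \<partial>\<gamma>) \<le> (\<integral>\<^sup>+w. ennreal (norm (cX (fst w) + cY (snd w))) \<partial>\<gamma>)"
  proof (rule nn_integral_mono)
    fix w :: "real \<times> real"
    have "c (fst w) (snd w) \<le> \<bar>cX (fst w) + cY (snd w)\<bar>"
      using c[of "fst w" "snd w"] by linarith
    then show "(case w of (x, y) \<Rightarrow> ennreal (c x y)) \<le> ennreal (norm (cX (fst w) + cY (snd w)))"
      by (simp add: split_beta ennreal_leI)
  qed
  also have "\<dots> < \<infinity>" using int by (simp add: integrable_iff_bounded)
  finally show ?thesis by simp
qed

lemma optimal_coupling_preserves_signature_support:
  assumes h: "strictly_convex h" "\<And>x. h x \<ge> 0" and c: "\<And>x y. c x y = h (y - x)"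
    and opt: "optimal_coupling c \<alpha> \<beta> \<gamma>"
    and fin: "finite_measure \<alpha>" and cost: "(\<integral>\<^sup>+(x, y). ennreal (c x y) \<partial>\<gamma>) \<noteq> \<infinity>"
    and sets: "sets \<alpha> = sets borel" "sets \<beta> = sets borel"
    and p: "p 0 = -\<infinity>" "\<And>i. i < n \<Longrightarrow> p i < p (Suc i)"
    and q: "q 0 = -\<infinity>" "\<And>i. i < n \<Longrightarrow> q i < q (Suc i)"
    and mass: "\<And>i. i < n \<Longrightarrow> emeasure \<alpha> (signature_interval p i) = emeasure \<beta> (signature_interval q i)"
    and I: "I \<subseteq> {..<n}"
  shows "AE w in \<gamma>. fst w \<in> signature_support p I \<longleftrightarrow> snd w \<in> signature_support q I"
proof -
  have borel: "{x. ereal x \<le> r} \<in> sets borel" for r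
  proof -
    have "{x \<in> space borel. ereal x \<le> r} \<in> sets borel" by measurable
    then show ?thesis by simp
  qed
  have lower: "x < x'" if "x \<in> {x. ereal x \<le> r}" "x' \<notin> {x. ereal x \<le> r}" for x x' r
    using that less_ereal.simps(1)[of x x'] by (auto simp del: less_ereal.simps)
  have "AE w in \<gamma>. fst w \<in> {x. ereal x \<le> p k} \<longleftrightarrow> snd w \<in> {y. ereal y \<le> q k}" if k: "k \<in> {..n}" for k
  proof (rule optimal_coupling_preserves_cut[OF h c opt fin cost borel lower borel lower])
    show "emeasure \<alpha> {x. ereal x \<le> p k} = emeasure \<beta> {y. ereal y \<le> q k}"
      using k mass emeasure_lower_signature_interval[OF p sets(1), of k]
        emeasure_lower_signature_interval[OF q sets(2), of k] by (auto intro!: sum.cong)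
  qed
  then have "AE w in \<gamma>. \<forall>k\<in>{..n}. fst w \<in> {x. ereal x \<le> p k} \<longleftrightarrow> snd w \<in> {y. ereal y \<le> q k}"
    by (intro AE_finite_allI) auto
  then show ?thesis
  proof eventually_elim
    case (elim w)
    have "fst w \<in> signature_interval p i \<longleftrightarrow> snd w \<in> signature_interval q i" if "i \<in> I" for i
    proof -
      have "i \<in> {..n}" "Suc i \<in> {..n}" using that I by auto
      then show ?thesis using elim[rule_format, of i] elim[rule_format, of "Suc i"]
        by (simp add: signature_interval_def not_le[symmetric])
    qed
    then show ?case by (simp add: signature_support_def)
  qed
qed

theorem theorem5p4:
  fixes h :: "real \<Rightarrow> real"
    and c :: "real \<Rightarrow> real \<Rightarrow> real"
    and cX cY :: "real \<Rightarrow> real"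
    and a b :: "real set \<Rightarrow> real"
    and z :: "real list"
    and \<alpha> \<beta> :: "real measure"
    and \<gamma> :: "(real \<times> real) measure"
  assumes h_nonneg: "\<And>x. h x \<ge> 0"
    and h_convex: "strictly_convex h"
    and c_eq: "\<And>x y. c x y = h (y - x)"
    and cX_meas: "cX \<in> borel_measurable borel"
    and cY_meas: "cY \<in> borel_measurable borel"
    and c_le: "\<And>x y. c x y \<le> cX x + cY y"
    and a_signed: "finite_signed_measure a"
    and b_signed: "finite_signed_measure b"
    and a_sig: "has_signature a z"
    and b_sig: "has_signature b z"
    and \<alpha>_eq: "\<alpha> = total_variation a"
    and \<beta>_eq: "\<beta> = total_variation b"
    and cX_int: "integrable \<alpha> cX"
    and cY_int: "integrable \<beta> cY"
    and \<gamma>_opt: "optimal_coupling c \<alpha> \<beta> \<gamma>"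
  shows "a \<in> kernel_domain cX \<alpha> \<and> (\<forall>B\<in>sets borel. kernel_apply \<alpha> \<gamma> a B = b B)"
proof -
  let ?n = "length z"
  let ?I = "{i. i < ?n \<and> z ! i > 0}" and ?J = "{i. i < ?n \<and> z ! i < 0}"
  obtain p where p: "p 0 = -\<infinity>" "p ?n = \<infinity>" "\<And>i. i < ?n \<Longrightarrow> p i < p (Suc i)"
    and \<alpha>p: "\<And>i. i < ?n \<Longrightarrow> emeasure \<alpha> (signature_interval p i) = ennreal \<bar>z ! i\<bar>"
    and aP: "\<And>A. A \<in> sets borel \<Longrightarrow> emeasure (pos_part a) A = emeasure \<alpha> (A \<inter> signature_support p ?I)"
    and aN: "\<And>A. A \<in> sets borel \<Longrightarrow> emeasure (neg_part a) A = emeasure \<alpha> (A \<inter> signature_support p ?J)"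
    by (rule has_signature_total_variation[OF a_sig]) (rule that[unfolded \<alpha>_eq]; assumption)
  obtain q where q: "q 0 = -\<infinity>" "q ?n = \<infinity>" "\<And>i. i < ?n \<Longrightarrow> q i < q (Suc i)"
    and \<beta>q: "\<And>i. i < ?n \<Longrightarrow> emeasure \<beta> (signature_interval q i) = ennreal \<bar>z ! i\<bar>"
    and bP: "\<And>A. A \<in> sets borel \<Longrightarrow> emeasure (pos_part b) A = emeasure \<beta> (A \<inter> signature_support q ?I)"
    and bN: "\<And>A. A \<in> sets borel \<Longrightarrow> emeasure (neg_part b) A = emeasure \<beta> (A \<inter> signature_support q ?J)"
    by (rule has_signature_total_variation[OF b_sig]) (rule that[unfolded \<beta>_eq]; assumption)
  define S where "S = signature_support p ?I"
  define S' where "S' = signature_support p ?J"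
  define T where "T = signature_support q ?I"
  define T' where "T' = signature_support q ?J"
  have [measurable]: "S \<in> sets borel" "S' \<in> sets borel" "T \<in> sets borel" "T' \<in> sets borel"
    by (simp_all add: S_def S'_def T_def T'_def signature_support_borel)
  have sets: "sets \<alpha> = sets borel" "sets \<beta> = sets borel"
    by (simp_all add: \<alpha>_eq \<beta>_eq sets_total_variation)
  note Ja = jordan_decomposition_pos_neg_part[OF a_signed]
    and Jb = jordan_decomposition_pos_neg_part[OF b_signed]
  have fin: "finite_measure \<alpha>" "finite_measure \<beta>"
    unfolding \<alpha>_eq \<beta>_eq by (rule finite_measure_total_variation; fact)+
  have cp: "coupling \<alpha> \<beta> \<gamma>" using \<gamma>_opt by (simp add: optimal_coupling_def)
  then have sets\<gamma>: "sets \<gamma> = sets borel" and \<alpha>: "\<alpha> = distr \<gamma> borel fst" and \<beta>: "\<beta> = distr \<gamma> borel snd"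
    by (simp_all add: coupling_def)
  note m[measurable] = coupling_measurable[OF cp]
  have cost: "(\<integral>\<^sup>+(x, y). ennreal (c x y) \<partial>\<gamma>) \<noteq> \<infinity>"
    by (rule coupling_cost_finite[OF cp c_le cX_int cY_int])
  have mass: "emeasure \<alpha> (signature_interval p i) = emeasure \<beta> (signature_interval q i)" if "i < ?n" for i
    using \<alpha>p \<beta>q that by simp
  have "AE w in \<gamma>. fst w \<in> S \<longleftrightarrow> snd w \<in> T" "AE w in \<gamma>. fst w \<in> S' \<longleftrightarrow> snd w \<in> T'"
    unfolding S_def S'_def T_def T'_def
    by (rule optimal_coupling_preserves_signature_support[OF h_convex h_nonneg c_eq \<gamma>_opt fin(1) cost
          sets p(1,3) q(1,3) mass]; auto)+
  moreover have RN: "AE x in \<alpha>. signed_RN_deriv \<alpha> a x = indicator S x - indicator S' x"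
    using Ja aP aN fin(1) sets(1)
    by (intro signed_RN_deriv_supports) (simp_all add: jordan_decomposition_def S_def S'_def signature_support_borel)
  then have "AE w in \<gamma>. signed_RN_deriv \<alpha> a (fst w) = indicator S (fst w) - indicator S' (fst w)"
    unfolding \<alpha> by (rule AE_distrD[OF m(1)])
  ultimately have key: "AE w in \<gamma>. signed_RN_deriv \<alpha> a (fst w) = indicator T (snd w) - indicator T' (snd w)"
    by eventually_elim (simp split: split_indicator)
  have domain: "a \<in> kernel_domain cX \<alpha>"
  proof -
    have "AE x in \<alpha>. \<bar>signed_RN_deriv \<alpha> a x\<bar> \<le> 1"
      using RN by eventually_elim (simp split: split_indicator)
    then show ?thesis using a_signed cX_int
      unfolding kernel_domain_def by (auto simp: \<alpha>_eq absolutely_continuous_def)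
  qed
  have "kernel_apply \<alpha> \<gamma> a B = b B" if B[measurable]: "B \<in> sets borel" for B
  proof -
    have [measurable]: "signed_RN_deriv \<alpha> a \<in> borel_measurable borel"
      using sets(1) unfolding signed_RN_deriv_def by measurable
    have "kernel_apply \<alpha> \<gamma> a B = (LINT w|\<gamma>. indicator B (snd w) * signed_RN_deriv \<alpha> a (fst w))"
      unfolding kernel_apply_def signed_distr_def signed_density_def set_lebesgue_integral_def
      by (auto intro!: Bochner_Integration.integral_cong split: split_indicator)
    also have "\<dots> = (LINT w|\<gamma>. indicator B (snd w) * (indicator T (snd w) - indicator T' (snd w)))"
      using key by (intro integral_cong_AE) (measurable, auto)
    also have "\<dots> = (LINT y|\<beta>. indicator B y * (indicator T y - indicator T' y))"
      unfolding \<beta> by (subst integral_distr) auto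
    also have "\<dots> = (LINT y|\<beta>. indicator (B \<inter> T) y - indicator (B \<inter> T') y)"
      by (auto intro!: Bochner_Integration.integral_cong split: split_indicator)
    also have "\<dots> = measure \<beta> (B \<inter> T) - measure \<beta> (B \<inter> T')"
    proof -
      interpret finite_measure \<beta> by (rule fin(2))
      show ?thesis using sets(2)
        by (subst Bochner_Integration.integral_diff) (auto simp: emeasure_eq_measure)
    qed
    also have "\<dots> = measure (pos_part b) B - measure (neg_part b) B"
      using bP[OF B] bN[OF B] by (simp add: measure_def T_def T'_def)
    also have "\<dots> = b B" using Jb B by (simp add: jordan_decomposition_def)
    finally show ?thesis .
  qed
  then show ?thesis using domain by blast
qed

end
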